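(* Let $m\ge 1$ and $l$ be integers with $l-m-1\ge 1$, let $\{P_0,\dots,P_m\}$ be a symmetric Clifford system on $\mathbb{R}^{2l}$, with orthonormal coordinates of $\mathbb{R}^{2l}$ chosen so that the system is in the normal form described in the context, with skew-symmetric matrices $E_1,\dots,E_{m-1}\in\mathbb{R}^{l\times l}$, and let $R_1,\dots,R_l\in\mathbb{R}^{m\times l}$ be the associated matrices. Let $$G_F(x)=|x|^4-\sum_{\alpha=0}^m\langle P_\alpha x,x\rangle^2,\qquad x\in\mathbb{R}^{2l}.$$ Then $G_F$ is a sum of squares of real polynomials if and only if there exists a real symmetric $l^2\times l^2$ matrix $B=(B_{ik})_{i,k=1}^{l}$, viewed as an $l\times l$ block matrix with blocks $B_{ik}\in\mathbb{R}^{l\times l}$, such that $$\begin{cases} B\succeq 0,\\ B_{ii}=I_l\ \ (1\le i\le l),\qquad B_{ik}=-B_{ik}^{T}\ \ (1\le i\neq k\le l),\\ R_iB_{ij}=R_j\ \ (1\le i,j\le l).\end{cases}$$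
   Context: A symmetric Clifford system on $\mathbb{R}^{2l}$ is a family $\{P_0,\dots,P_m\}$ of real symmetric $2l\times 2l$ matrices with $P_\alpha P_\beta+P_\beta P_\alpha=2\delta_{\alpha\beta}I_{2l}$. The associated OT-FKM type isoparametric polynomial is $F(x)=|x|^4-2\sum_{\alpha=0}^m\langle P_\alpha x,x\rangle^2$, with multiplicity pair $(m_+,m_-)=(m,l-m-1)$, both entries positive, and $G_F=(|x|^4+F)/2$. Normal form: in suitable orthonormal coordinates (adapted to the eigenspaces $E_\pm(P_0)$), $$P_0=\begin{pmatrix} I_l&0\\ 0&-I_l\end{pmatrix},\quad P_1=\begin{pmatrix}0&I_l\\ I_l&0\end{pmatrix},\quad P_{\alpha+1}=\begin{pmatrix}0&E_\alpha\\ -E_\alpha&0\end{pmatrix}\ (1\le\alpha\le m-1),$$ where $E_1,\dots,E_{m-1}$ are skew-symmetric real $l\times l$ matrices with $E_\alpha E_\beta+E_\beta E_\alpha=-2\delta_{\alpha\beta}I_l$. Put $E_0:=I_l$. For $1\le q\le l$, $R_q\in\mathbb{R}^{m\times l}$ is the matrix whose $\alpha$-th row ($1\le\alpha\le m$) is the $q$-th row of $E_{\alpha-1}$. $B\succeq0$ means that $B$ is (symmetric) positive semidefinite. *)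

theory Defs
  imports "Jordan_Normal_Form.Matrix" "HOL-Library.Poly_Mapping"
begin

definition symmetric_clifford_system :: "nat \<Rightarrow> nat \<Rightarrow> (nat \<Rightarrow> real mat) \<Rightarrow> bool" where
  "symmetric_clifford_system n m P \<longleftrightarrow>
     (\<forall>\<alpha>\<le>m. P \<alpha> \<in> carrier_mat n n \<and> transpose_mat (P \<alpha>) = P \<alpha>) \<and>
     (\<forall>\<alpha>\<le>m. \<forall>\<beta>\<le>m. P \<alpha> * P \<beta> + P \<beta> * P \<alpha>
        = (if \<alpha> = \<beta> then 2 else 0) \<cdot>\<^sub>m 1\<^sub>m n)"

text \<open>Only the values of \<open>E\<close> at \<open>1, \<dots>, m - 1\<close> matter; the convention \<open>E\<^sub>0 = I\<close> is
  built into \<open>row_matrix\<close> below.\<close>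

definition clifford_normal_form ::
    "nat \<Rightarrow> nat \<Rightarrow> (nat \<Rightarrow> real mat) \<Rightarrow> (nat \<Rightarrow> real mat) \<Rightarrow> bool" where
  "clifford_normal_form l m P E \<longleftrightarrow>
     P 0 = four_block_mat (1\<^sub>m l) (0\<^sub>m l l) (0\<^sub>m l l) (- 1\<^sub>m l) \<and>
     P 1 = four_block_mat (0\<^sub>m l l) (1\<^sub>m l) (1\<^sub>m l) (0\<^sub>m l l) \<and>
     (\<forall>\<alpha>\<in>{1..m - 1}. E \<alpha> \<in> carrier_mat l l \<and> transpose_mat (E \<alpha>) = - E \<alpha> \<and>
        P (\<alpha> + 1) = four_block_mat (0\<^sub>m l l) (E \<alpha>) (- E \<alpha>) (0\<^sub>m l l)) \<and>
     (\<forall>\<alpha>\<in>{1..m - 1}. \<forall>\<beta>\<in>{1..m - 1}. E \<alpha> * E \<beta> + E \<beta> * E \<alpha>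
        = (if \<alpha> = \<beta> then - 2 else 0) \<cdot>\<^sub>m 1\<^sub>m l)"

text \<open>Matrix rows, columns and blocks are numbered from 0. Thus row \<open>a\<close> of \<open>row_matrix l m E q\<close>,
  for \<open>a < m\<close> and \<open>q < l\<close>, is row \<open>q\<close> of \<open>E\<^sub>a\<close>; it is the row with 1-based number
  \<open>\<alpha> = a + 1\<close> of the matrix usually written \<open>R\<close> with index \<open>q + 1\<close>.\<close>

definition row_matrix :: "nat \<Rightarrow> nat \<Rightarrow> (nat \<Rightarrow> real mat) \<Rightarrow> nat \<Rightarrow> real mat" where
  "row_matrix l m E q = mat m l (\<lambda>(a, b). (if a = 0 then 1\<^sub>m l else E a) $$ (q, b))"

definition mat_block :: "nat \<Rightarrow> real mat \<Rightarrow> nat \<Rightarrow> nat \<Rightarrow> real mat" where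
  "mat_block l B i k = mat l l (\<lambda>(a, b). B $$ (i * l + a, k * l + b))"

definition pos_semidef :: "nat \<Rightarrow> real mat \<Rightarrow> bool" where
  "pos_semidef n B \<longleftrightarrow> B \<in> carrier_mat n n \<and> transpose_mat B = B \<and>
     (\<forall>v\<in>carrier_vec n. 0 \<le> v \<bullet> (B *\<^sub>v v))"

definition G_F :: "nat \<Rightarrow> (nat \<Rightarrow> real mat) \<Rightarrow> real vec \<Rightarrow> real" where
  "G_F m P x = (x \<bullet> x)^2 - (\<Sum>\<alpha>\<le>m. ((P \<alpha> *\<^sub>v x) \<bullet> x)^2)"

text \<open>A multivariate polynomial is a finitely supported map from monomials to coefficients, and
  a monomial is a finitely supported map from variable indices to exponents.\<close>

type_synonym real_mpoly = "(nat \<Rightarrow>\<^sub>0 nat) \<Rightarrow>\<^sub>0 real"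

definition mpolys_in :: "nat \<Rightarrow> real_mpoly set" where
  "mpolys_in n = {p. \<forall>mon\<in>Poly_Mapping.keys p. Poly_Mapping.keys mon \<subseteq> {..<n}}"

definition mpoly_eval :: "real_mpoly \<Rightarrow> real vec \<Rightarrow> real" where
  "mpoly_eval p x = (\<Sum>mon\<in>Poly_Mapping.keys p. Poly_Mapping.lookup p mon *
     (\<Prod>i\<in>Poly_Mapping.keys mon. (x $ i) ^ Poly_Mapping.lookup mon i))"

text \<open>Polynomials and polynomial functions over the infinite field of reals correspond
  bijectively, so a polynomial identity is stated as an identity of functions.\<close>

definition sum_of_squares_of_polys :: "nat \<Rightarrow> (real vec \<Rightarrow> real) \<Rightarrow> bool" where
  "sum_of_squares_of_polys n f \<longleftrightarrow>
     (\<exists>(r::nat) (q :: nat \<Rightarrow> real_mpoly). (\<forall>k<r. q k \<in> mpolys_in n) \<and>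
        (\<forall>x\<in>carrier_vec n. f x = (\<Sum>k<r. (mpoly_eval (q k) x)^2)))"

end

theory Submission
  imports Defs "HOL-Computational_Algebra.Fundamental_Theorem_Algebra"
begin

text \<open>
  Write \<open>x = (u, v)\<close> with \<open>u, v \<in> \<real>\<^sup>l\<close>. In the normal form, \<open>P\<^sub>0\<close> contributes
  \<open>(\<bar>u\<bar>\<^sup>2 - \<bar>v\<bar>\<^sup>2)\<^sup>2\<close> and the other \<open>P\<^sub>\<alpha>\<close> contribute the squares of
  \<open>2 \<langle>u, E\<^sub>a v\<rangle>\<close> for \<open>a < m\<close>, so that
  \<open>G\<^sub>F (x) = 4 (\<bar>u\<bar>\<^sup>2 \<bar>v\<bar>\<^sup>2 - \<Sum>\<^sub>a \<langle>u, E\<^sub>a v\<rangle>\<^sup>2)\<close>.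
  The bracket is a quadratic form in the tensor \<open>z = u \<otimes> v\<close>: if \<open>\<R>\<close> denotes the
  \<open>m \<times> l\<^sup>2\<close> matrix \<open>(R\<^sub>1, \<dots>, R\<^sub>l)\<close>, then \<open>\<Sum>\<^sub>a \<langle>u, E\<^sub>a v\<rangle>\<^sup>2 = \<bar>\<R> z\<bar>\<^sup>2\<close>. A symmetric matrix \<open>B\<close> represents
  \<open>\<bar>u\<bar>\<^sup>2 \<bar>v\<bar>\<^sup>2\<close> as \<open>z\<^sup>T B z\<close> exactly when its blocks satisfy the identity and skew-symmetry
  conditions. The Clifford relations enter through the fact that the rows of each \<open>R\<^sub>q\<close> are
  orthonormal (\<open>normal_form_rows_orthonormal\<close>).

  Suppose that \<open>G\<^sub>F\<close> is a sum of squares. Each summand is at most \<open>4 \<bar>u\<bar>\<^sup>2 \<bar>v\<bar>\<^sup>2\<close>, and a polynomial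
  whose absolute value is bounded by a multiple of \<open>\<bar>u\<bar> \<bar>v\<bar>\<close> is bilinear
  (\<open>mpoly_bilin_form_of_growth\<close>). Hence the bracket is \<open>\<Sum>\<^sub>t (c\<^sub>t \<cdot> z)\<^sup>2\<close> with vectors \<open>c\<^sub>t\<close>, and
  \<open>B = \<R>\<^sup>T \<R> + \<Sum>\<^sub>t c\<^sub>t c\<^sub>t\<^sup>T\<close> is positive semidefinite and represents \<open>\<bar>u\<bar>\<^sup>2 \<bar>v\<bar>\<^sup>2\<close>. The bracket
  vanishes at \<open>z = e\<^sub>i \<otimes> r\<close> for every row \<open>r\<close> of \<open>R\<^sub>i\<close>, so every \<open>c\<^sub>t\<close> is orthogonal to this \<open>z\<close>;
  this gives \<open>R\<^sub>i B\<^sub>i\<^sub>j = R\<^sub>j\<close> (\<open>gram_conditions_of_bilinear_squares\<close>).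

  Conversely, given \<open>B\<close>, the equations \<open>R\<^sub>i B\<^sub>i\<^sub>j = R\<^sub>j\<close> say that \<open>B\<close> maps certain preimages, namely
  the rows of one \<open>R\<^sub>i\<close> placed in the \<open>i\<close>-th block, to the rows of \<open>\<R>\<close>. Subtracting suitable
  combinations of these preimages from a test vector shows that \<open>B - \<R>\<^sup>T \<R>\<close> is positive
  semidefinite (\<open>psd_minus_gram\<close>). A positive semidefinite form is a sum of squares of linear
  forms (\<open>psd_form_sum_of_squares\<close>), and linear forms in \<open>u \<otimes> v\<close> are polynomials in \<open>x\<close>.
\<close>

section \<open>Positive semidefinite quadratic forms\<close>

definition quad_form :: "'a set \<Rightarrow> ('a \<Rightarrow> 'a \<Rightarrow> real) \<Rightarrow> ('a \<Rightarrow> real) \<Rightarrow> real" where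
  "quad_form I A y = (\<Sum>i\<in>I. \<Sum>j\<in>I. A i j * y i * y j)"

lemma quad_form_cong:
  assumes "\<And>i. i \<in> I \<Longrightarrow> y i = z i"
  shows "quad_form I A y = quad_form I A z"
  unfolding quad_form_def using assms by (intro sum.cong refl) auto

lemma quad_form_insert:
  assumes "finite I" "p \<notin> I" "\<And>i. i \<in> I \<Longrightarrow> A i p = A p i"
  shows "quad_form (insert p I) A y
    = A p p * (y p)^2 + 2 * y p * (\<Sum>i\<in>I. A p i * y i) + quad_form I A y"
proof -
  have "(\<Sum>i\<in>I. A i p * y i * y p) = y p * (\<Sum>i\<in>I. A p i * y i)"
    using assms(3) by (simp add: sum_distrib_left mult_ac)
  moreover have "(\<Sum>j\<in>I. A p j * y p * y j) = y p * (\<Sum>i\<in>I. A p i * y i)"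
    by (simp add: sum_distrib_left mult_ac)
  ultimately show ?thesis
    using assms(1,2) by (simp add: quad_form_def sum.distrib power2_eq_square algebra_simps)
qed

lemma quad_form_gram:
  assumes "finite I"
  shows "quad_form I (\<lambda>i j. \<Sum>k\<in>K. c k i * c k j) y = (\<Sum>k\<in>K. (\<Sum>i\<in>I. c k i * y i)^2)"
proof -
  have "quad_form I (\<lambda>i j. \<Sum>k\<in>K. c k i * c k j) y
      = (\<Sum>i\<in>I. \<Sum>j\<in>I. \<Sum>k\<in>K. (c k i * y i) * (c k j * y j))"
    by (simp add: quad_form_def sum_distrib_left sum_distrib_right mult_ac)
  also have "\<dots> = (\<Sum>i\<in>I. \<Sum>k\<in>K. \<Sum>j\<in>I. (c k i * y i) * (c k j * y j))"
    by (rule sum.cong[OF refl], rule sum.swap)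
  also have "\<dots> = (\<Sum>k\<in>K. \<Sum>i\<in>I. \<Sum>j\<in>I. (c k i * y i) * (c k j * y j))"
    by (rule sum.swap)
  also have "\<dots> = (\<Sum>k\<in>K. (\<Sum>i\<in>I. c k i * y i)^2)"
    by (simp add: power2_eq_square sum_product)
  finally show ?thesis .
qed

text \<open>Completing the square in one variable at a time. If the coefficient of \<open>(y p)\<^sup>2\<close> is positive, the
  rest is a Schur complement, which is again positive semidefinite because it is the minimum of
  the form over \<open>y p\<close>. If that coefficient vanishes, so do all the mixed terms with \<open>y p\<close>, as the
  form would otherwise be unbounded below.\<close>

lemma psd_form_sum_of_squares:
  assumes "finite I" "\<And>i j. i \<in> I \<Longrightarrow> j \<in> I \<Longrightarrow> A i j = A j i"
    and "\<And>y. 0 \<le> quad_form I A y"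
  shows "\<exists>(n::nat) c. \<forall>y. quad_form I A y = (\<Sum>k<n. (\<Sum>i\<in>I. c k i * y i)^2)"
  using assms
proof (induction I arbitrary: A rule: finite_induct)
  case empty
  show ?case by (intro exI[of _ 0]) (simp add: quad_form_def)
next
  case (insert p I)
  let ?d = "A p p"
  let ?L = "\<lambda>y. \<Sum>i\<in>I. A p i * y i"
  have expand: "quad_form (insert p I) A y = ?d * (y p)^2 + 2 * y p * ?L y + quad_form I A y" for y
    using insert.hyps insert.prems(1) by (intro quad_form_insert) auto
  have pos: "0 \<le> ?d * t^2 + 2 * t * ?L y + quad_form I A y" for t y
  proof -
    have "?L (y(p := t)) = ?L y" "quad_form I A (y(p := t)) = quad_form I A y"
      using insert.hyps by (auto intro!: sum.cong quad_form_cong)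
    with insert.prems(2)[of "y(p := t)"] show ?thesis
      unfolding expand by simp
  qed
  have psd_I: "0 \<le> quad_form I A y" for y
    using pos[of 0 y] by simp
  show ?case
  proof (cases "?d = 0")
    case True
    have L0: "?L y = 0" for y
    proof (rule ccontr)
      assume "?L y \<noteq> 0"
      \<comment> \<open>the form is affine in \<open>t\<close> here, and this \<open>t\<close> gives it the value \<open>-1\<close>\<close>
      with pos[of "- (quad_form I A y + 1) / (2 * ?L y)" y] True show False
        by (simp add: field_simps)
    qed
    obtain n c where nc: "\<And>y. quad_form I A y = (\<Sum>k<(n::nat). (\<Sum>i\<in>I. c k i * y i)^2)"
      using insert.IH[of A] insert.prems(1) psd_I by blast
    have "(\<Sum>i\<in>insert p I. ((c k)(p := 0)) i * y i) = (\<Sum>i\<in>I. c k i * y i)" for k and y :: "'a \<Rightarrow> real"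
      using insert.hyps by (auto intro!: sum.cong)
    then have "\<forall>y. quad_form (insert p I) A y
        = (\<Sum>k<n. (\<Sum>i\<in>insert p I. ((c k)(p := 0)) i * y i)^2)"
      using L0 True unfolding expand nc by simp
    then show ?thesis by (intro exI[of _ n] exI[of _ "\<lambda>k. (c k)(p := 0)"])
  next
    case False
    have "0 \<le> ?d"
      using pos[of 1 "\<lambda>_. 0"] by (simp add: quad_form_def)
    with False have d: "?d > 0" by simp
    \<comment> \<open>the Schur complement of the entry at \<open>p\<close>\<close>
    define A' where "A' = (\<lambda>i j. A i j - A p i * A p j / ?d)"
    have A': "quad_form I A' y = quad_form I A y - (?L y)^2 / ?d" for y
      by (simp add: A'_def quad_form_def power2_eq_square sum_product sum_divide_distrib
          sum_subtractf algebra_simps)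
    \<comment> \<open>the minimum of the form over \<open>y p\<close> is attained at \<open>- ?L y / ?d\<close>\<close>
    have "0 \<le> quad_form I A' y" for y
      using pos[of "- ?L y / ?d" y] d unfolding A'
      by (simp add: power2_eq_square field_simps)
    moreover have "A' i j = A' j i" if "i \<in> I" "j \<in> I" for i j
      using that insert.prems(1) by (simp add: A'_def)
    ultimately obtain n c where
      nc: "\<And>y. quad_form I A' y = (\<Sum>k<(n::nat). (\<Sum>i\<in>I. c k i * y i)^2)"
      using insert.IH[of A'] by blast
    define c' where "c' = (\<lambda>k. if k < n then (c k)(p := 0) else (\<lambda>i. A p i / sqrt ?d))"
    have old: "(\<Sum>i\<in>insert p I. c' k i * y i) = (\<Sum>i\<in>I. c k i * y i)" if "k < n" for k y
      using insert.hyps that by (auto simp: c'_def intro!: sum.cong)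
    have new: "(\<Sum>i\<in>insert p I. c' n i * y i) = (?d * y p + ?L y) / sqrt ?d" for y
      using insert.hyps by (simp add: c'_def sum_divide_distrib add_divide_distrib)
    have "quad_form (insert p I) A y = (\<Sum>k<Suc n. (\<Sum>i\<in>insert p I. c' k i * y i)^2)" for y
    proof -
      have "(\<Sum>k<Suc n. (\<Sum>i\<in>insert p I. c' k i * y i)^2)
          = quad_form I A' y + ((?d * y p + ?L y) / sqrt ?d)^2"
        using old by (simp add: new nc)
      also have "((?d * y p + ?L y) / sqrt ?d)^2 = (?d * y p + ?L y)^2 / ?d"
        using d by (simp add: power_divide)
      also have "\<dots> = ?d * (y p)^2 + 2 * y p * ?L y + (?L y)^2 / ?d"
        using d by (simp add: field_simps power2_eq_square)
      finally show ?thesis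
        by (simp add: expand A')
    qed
    then show ?thesis by blast
  qed
qed

text \<open>The vectors \<open>r e\<close> are preimages of the \<open>\<rho> e\<close> under \<open>A\<close>, and the two families are biorthonormal.
  So \<open>\<Sum>\<^sub>e \<rho>\<^sub>e \<rho>\<^sub>e\<^sup>T\<close> agrees with \<open>A\<close> on the span of the \<open>r e\<close>, and subtracting it from \<open>A\<close> leaves the
  form \<open>A\<close> evaluated on the component \<open>y - w\<close> that is \<open>A\<close>-orthogonal to this span.\<close>

lemma psd_minus_gram:
  fixes \<rho> r :: "'e \<Rightarrow> 'a \<Rightarrow> real"
  assumes fin: "finite I" "finite E"
    and sym: "\<And>i j. i \<in> I \<Longrightarrow> j \<in> I \<Longrightarrow> A i j = A j i"
    and psd: "\<And>y. 0 \<le> quad_form I A y"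
    and image: "\<And>e i. e \<in> E \<Longrightarrow> i \<in> I \<Longrightarrow> (\<Sum>j\<in>I. A i j * r e j) = \<rho> e i"
    and dual: "\<And>e f. e \<in> E \<Longrightarrow> f \<in> E \<Longrightarrow> (\<Sum>i\<in>I. \<rho> e i * r f i) = (if e = f then 1 else 0)"
  shows "(\<Sum>e\<in>E. (\<Sum>i\<in>I. \<rho> e i * y i)^2) \<le> quad_form I A y"
proof -
  define s where "s = (\<lambda>e. \<Sum>i\<in>I. \<rho> e i * y i)"
  \<comment> \<open>the \<open>A\<close>-orthogonal projection of \<open>y\<close> to the span of the \<open>r e\<close>\<close>
  define w where "w = (\<lambda>i. \<Sum>e\<in>E. s e * r e i)"
  have Aw: "(\<Sum>j\<in>I. A i j * w j) = (\<Sum>e\<in>E. s e * \<rho> e i)" if "i \<in> I" for i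
  proof -
    have "(\<Sum>j\<in>I. A i j * w j) = (\<Sum>e\<in>E. s e * (\<Sum>j\<in>I. A i j * r e j))"
      unfolding w_def sum_distrib_left by (subst sum.swap) (simp add: mult_ac)
    then show ?thesis using image that by simp
  qed
  have yAw: "(\<Sum>i\<in>I. y i * (\<Sum>j\<in>I. A i j * w j)) = (\<Sum>e\<in>E. (s e)^2)"
  proof -
    have "(\<Sum>i\<in>I. y i * (\<Sum>j\<in>I. A i j * w j)) = (\<Sum>i\<in>I. \<Sum>e\<in>E. s e * (\<rho> e i * y i))"
      using Aw by (simp add: sum_distrib_left mult_ac)
    also have "\<dots> = (\<Sum>e\<in>E. s e * s e)"
      by (subst sum.swap) (simp add: s_def sum_distrib_left)
    finally show ?thesis by (simp add: power2_eq_square)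
  qed
  have wAw: "(\<Sum>i\<in>I. w i * (\<Sum>j\<in>I. A i j * w j)) = (\<Sum>e\<in>E. (s e)^2)"
  proof -
    have "(\<Sum>i\<in>I. w i * (\<Sum>j\<in>I. A i j * w j)) = (\<Sum>i\<in>I. \<Sum>e\<in>E. s e * (\<rho> e i * w i))"
      using Aw by (simp add: sum_distrib_left mult_ac)
    also have "\<dots> = (\<Sum>e\<in>E. s e * (\<Sum>i\<in>I. \<rho> e i * w i))"
      by (subst sum.swap) (simp add: sum_distrib_left)
    also have "\<dots> = (\<Sum>e\<in>E. s e * (\<Sum>f\<in>E. s f * (\<Sum>i\<in>I. \<rho> e i * r f i)))"
      unfolding w_def sum_distrib_left
      by (intro sum.cong refl, subst sum.swap) (simp add: mult_ac)
    also have "\<dots> = (\<Sum>e\<in>E. s e * s e)"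
    proof (intro sum.cong refl)
      fix e assume e: "e \<in> E"
      have "(\<Sum>f\<in>E. s f * (\<Sum>i\<in>I. \<rho> e i * r f i)) = (\<Sum>f\<in>E. if e = f then s f else 0)"
        using dual e by (intro sum.cong) auto
      also have "\<dots> = s e" using e fin by simp
      finally show "s e * (\<Sum>f\<in>E. s f * (\<Sum>i\<in>I. \<rho> e i * r f i)) = s e * s e" by simp
    qed
    finally show ?thesis by (simp add: power2_eq_square)
  qed
  have wAy: "(\<Sum>i\<in>I. w i * (\<Sum>j\<in>I. A i j * y j)) = (\<Sum>i\<in>I. y i * (\<Sum>j\<in>I. A i j * w j))"
  proof -
    have "(\<Sum>i\<in>I. \<Sum>j\<in>I. w i * (A i j * y j)) = (\<Sum>j\<in>I. \<Sum>i\<in>I. y j * (A j i * w i))"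
      by (subst sum.swap) (intro sum.cong refl, simp add: sym mult_ac)
    then show ?thesis by (simp add: sum_distrib_left)
  qed
  have "quad_form I A (\<lambda>i. y i - w i) = quad_form I A y
      - (\<Sum>i\<in>I. y i * (\<Sum>j\<in>I. A i j * w j)) - (\<Sum>i\<in>I. w i * (\<Sum>j\<in>I. A i j * y j))
      + (\<Sum>i\<in>I. w i * (\<Sum>j\<in>I. A i j * w j))"
    by (simp add: quad_form_def sum_distrib_left sum.distrib sum_subtractf algebra_simps)
  with psd[of "\<lambda>i. y i - w i"] have "(\<Sum>e\<in>E. (s e)^2) \<le> quad_form I A y"
    by (simp add: wAy yAw wAw)
  then show ?thesis by (simp add: s_def)
qed

text \<open>Polarisation: the form is tested at \<open>e\<^sub>p + e\<^sub>q\<close>; the case \<open>p = q\<close> yields the diagonal.\<close>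

lemma quad_form_scalar_imp:
  assumes "finite I" and sym: "\<And>i j. i \<in> I \<Longrightarrow> j \<in> I \<Longrightarrow> A i j = A j i"
    and eq: "\<And>y. quad_form I A y = \<mu> * (\<Sum>i\<in>I. (y i)^2)"
    and "i \<in> I" "j \<in> I"
  shows "A i j = (if i = j then \<mu> else 0)"
proof -
  have pick: "(\<Sum>x\<in>I. f x * (of_bool (x = p) + of_bool (x = q))) = f p + f q"
    if "p \<in> I" "q \<in> I" for f :: "'a \<Rightarrow> real" and p q
  proof -
    have "(\<Sum>x\<in>I. f x * (of_bool (x = p) + of_bool (x = q)))
        = (\<Sum>x\<in>I. if x = p then f x else 0) + (\<Sum>x\<in>I. if x = q then f x else 0)"
      unfolding sum.distrib[symmetric] by (intro sum.cong) auto
    then show ?thesis using assms(1) that by simp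
  qed
  have polar: "quad_form I A (\<lambda>x. of_bool (x = p) + of_bool (x = q))
      = A p p + A q q + 2 * A p q" if pq: "p \<in> I" "q \<in> I" for p q
  proof -
    have "quad_form I A (\<lambda>x. of_bool (x = p) + of_bool (x = q))
        = (\<Sum>i\<in>I. (A i p + A i q) * (of_bool (i = p) + of_bool (i = q)))"
      unfolding quad_form_def using pq
      by (intro sum.cong refl) (simp only: pick, simp add: algebra_simps)
    also have "\<dots> = A p p + A p q + (A q p + A q q)"
      by (rule pick[OF pq])
    finally show ?thesis using sym[OF pq] by simp
  qed
  have norm: "(\<Sum>x\<in>I. (of_bool (x = p) + of_bool (x = q) :: real)^2) = (if p = q then 4 else 2)"
    if "p \<in> I" "q \<in> I" for p q
    unfolding power2_eq_square pick[OF that] by simp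
  have "A p p = \<mu>" if "p \<in> I" for p
    using polar[of p p] norm[of p p] eq[of "\<lambda>x. of_bool (x = p) + of_bool (x = p)"] that by simp
  then show ?thesis
    using polar[of i j] norm[of i j] eq[of "\<lambda>x. of_bool (x = i) + of_bool (x = j)"] assms(4,5)
    by auto
qed

section \<open>Bilinear forms and block matrices\<close>

definition bilin_form :: "nat \<Rightarrow> (nat \<Rightarrow> nat \<Rightarrow> real) \<Rightarrow> (nat \<Rightarrow> real) \<Rightarrow> (nat \<Rightarrow> real) \<Rightarrow> real" where
  "bilin_form l c u v = (\<Sum>i<l. \<Sum>j<l. c i j * u i * v j)"

abbreviation sq_norm_upto :: "nat \<Rightarrow> (nat \<Rightarrow> real) \<Rightarrow> real" where
  "sq_norm_upto l u \<equiv> (\<Sum>i<l. (u i)^2)"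

text \<open>If \<open>R i a j\<close> is the entry \<open>(i, j)\<close> of \<open>E\<^sub>a\<close>, this is \<open>G\<^sub>F / 4\<close> in terms of the halves \<open>u\<close> and \<open>v\<close> of
  the argument.\<close>

abbreviation biquadratic_gap :: "nat \<Rightarrow> nat \<Rightarrow> (nat \<Rightarrow> nat \<Rightarrow> nat \<Rightarrow> real) \<Rightarrow>
    (nat \<Rightarrow> real) \<Rightarrow> (nat \<Rightarrow> real) \<Rightarrow> real" where
  "biquadratic_gap l m R u v \<equiv>
     sq_norm_upto l u * sq_norm_upto l v - (\<Sum>a<m. (bilin_form l (\<lambda>i. R i a) u v)^2)"

abbreviation pair_range :: "nat \<Rightarrow> (nat \<times> nat) set" where
  "pair_range l \<equiv> {..<l} \<times> {..<l}"

lemma bilin_form_eq_tensor: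
  "bilin_form l c u v = (\<Sum>p\<in>pair_range l. case_prod c p * (u (fst p) * v (snd p)))"
  unfolding bilin_form_def sum.cartesian_product
  by (intro sum.cong) (auto simp: mult_ac)

lemma quad_form_tensor:
  "quad_form (pair_range l) B (\<lambda>p. u (fst p) * v (snd p))
    = (\<Sum>i<l. \<Sum>k<l. u i * u k * (\<Sum>a<l. \<Sum>b<l. B (i, a) (k, b) * v a * v b))"
proof -
  have "quad_form (pair_range l) B (\<lambda>p. u (fst p) * v (snd p))
      = (\<Sum>i<l. \<Sum>a<l. \<Sum>k<l. \<Sum>b<l. u i * u k * (B (i, a) (k, b) * v a * v b))"
    by (simp add: quad_form_def sum.cartesian_product' mult_ac)
  also have "\<dots> = (\<Sum>i<l. \<Sum>k<l. \<Sum>a<l. \<Sum>b<l. u i * u k * (B (i, a) (k, b) * v a * v b))"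
    by (rule sum.cong[OF refl], rule sum.swap)
  finally show ?thesis by (simp add: sum_distrib_left)
qed

text \<open>The quadratic form of a skew-symmetric block vanishes, so only the identity blocks on the diagonal
  contribute.\<close>

lemma quad_form_blocks_skew:
  assumes diag: "\<And>i a b. i < l \<Longrightarrow> a < l \<Longrightarrow> b < l \<Longrightarrow> B (i, a) (i, b) = (if a = b then 1 else 0)"
    and skew: "\<And>i k a b. i < l \<Longrightarrow> k < l \<Longrightarrow> i \<noteq> k \<Longrightarrow> a < l \<Longrightarrow> b < l \<Longrightarrow>
      B (i, a) (k, b) = - B (i, b) (k, a)"
  shows "quad_form (pair_range l) B (\<lambda>p. u (fst p) * v (snd p))
    = sq_norm_upto l u * sq_norm_upto l v"
proof -
  have block: "(\<Sum>a<l. \<Sum>b<l. B (i, a) (k, b) * v a * v b)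
      = (if i = k then sq_norm_upto l v else 0)" (is "?S = _") if "i < l" "k < l" for i k
  proof (cases "i = k")
    case True
    have "(\<Sum>b<l. B (i, a) (k, b) * v a * v b) = (v a)^2" if "a < l" for a
    proof -
      have "(\<Sum>b<l. B (i, a) (k, b) * v a * v b) = (\<Sum>b<l. if a = b then v a * v b else 0)"
        using diag \<open>i < l\<close> that True by (intro sum.cong) auto
      then show ?thesis using that by (simp add: power2_eq_square)
    qed
    then show ?thesis using True by simp
  next
    case False
    have "?S = (\<Sum>a<l. \<Sum>b<l. - (B (i, b) (k, a) * v b * v a))"
      by (rule sum.cong[OF refl], rule sum.cong[OF refl], subst skew[OF that False]) auto
    also have "\<dots> = (\<Sum>b<l. \<Sum>a<l. - (B (i, b) (k, a) * v b * v a))"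
      by (rule sum.swap)
    also have "\<dots> = - ?S" by (simp add: sum_negf)
    finally show ?thesis using False by simp
  qed
  have "quad_form (pair_range l) B (\<lambda>p. u (fst p) * v (snd p))
      = (\<Sum>i<l. \<Sum>k<l. if i = k then u i * u k * sq_norm_upto l v else 0)"
    unfolding quad_form_tensor
    by (rule sum.cong[OF refl], rule sum.cong[OF refl], subst block) auto
  then show ?thesis by (simp add: power2_eq_square flip: sum_distrib_right)
qed

text \<open>The polynomial \<open>\<Sum> u\<^sub>i u\<^sub>k v\<^sub>a v\<^sub>b B\<^sub>(\<^sub>i\<^sub>a\<^sub>)\<^sub>(\<^sub>k\<^sub>b\<^sub>)\<close> is a scalar form in \<open>v\<close> for each fixed \<open>u\<close>, which determines
  the coefficients of \<open>v\<^sub>a v\<^sub>b\<close>; these are in turn scalar forms in \<open>u\<close>. As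
  \<open>u\<^sub>i u\<^sub>k = u\<^sub>k u\<^sub>i\<close>, the second step sees only the part of \<open>B\<close> that is symmetrised in \<open>i\<close> and \<open>k\<close>.\<close>

lemma blocks_skew_of_quad_form:
  assumes sym: "\<And>p q. p \<in> pair_range l \<Longrightarrow> q \<in> pair_range l \<Longrightarrow> B p q = B q p"
    and eq: "\<And>u v. quad_form (pair_range l) B (\<lambda>p. u (fst p) * v (snd p))
      = sq_norm_upto l u * sq_norm_upto l v"
    and ik: "i < l" "k < l" and ab: "a < l" "b < l"
  shows "B (i, a) (k, b) + B (i, b) (k, a) = (if i = k \<and> a = b then 2 else 0)"
proof -
  \<comment> \<open>the coefficient matrix of the form in \<open>v\<close> for fixed \<open>u\<close>\<close>
  define N where "N = (\<lambda>u a b. \<Sum>i<l. \<Sum>k<l. u i * u k * B (i, a) (k, b))"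
  have N_sym: "N u a b = N u b a" if "a < l" "b < l" for u a b
    unfolding N_def using that
    by (subst sum.swap) (intro sum.cong refl, auto simp: sym mult_ac)
  have N_form: "quad_form {..<l} (N u) v = sq_norm_upto l u * sq_norm_upto l v" for u v
  proof -
    let ?X = "\<lambda>i k a b. u i * u k * (B (i, a) (k, b) * v a * v b)"
    have "quad_form {..<l} (N u) v = (\<Sum>a<l. \<Sum>b<l. \<Sum>i<l. \<Sum>k<l. ?X i k a b)"
      by (simp add: quad_form_def N_def sum_distrib_left sum_distrib_right mult_ac)
    also have "\<dots> = (\<Sum>a<l. \<Sum>i<l. \<Sum>b<l. \<Sum>k<l. ?X i k a b)"
      by (rule sum.cong[OF refl], rule sum.swap)
    also have "\<dots> = (\<Sum>i<l. \<Sum>a<l. \<Sum>b<l. \<Sum>k<l. ?X i k a b)"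
      by (rule sum.swap)
    also have "\<dots> = (\<Sum>i<l. \<Sum>a<l. \<Sum>k<l. \<Sum>b<l. ?X i k a b)"
      by (rule sum.cong[OF refl], rule sum.cong[OF refl], rule sum.swap)
    also have "\<dots> = (\<Sum>i<l. \<Sum>k<l. \<Sum>a<l. \<Sum>b<l. ?X i k a b)"
      by (rule sum.cong[OF refl], rule sum.swap)
    also have "\<dots> = quad_form (pair_range l) B (\<lambda>p. u (fst p) * v (snd p))"
      unfolding quad_form_tensor by (simp add: sum_distrib_left)
    finally show ?thesis by (simp add: eq)
  qed
  have N_entry: "N u a b = (if a = b then sq_norm_upto l u else 0)" for u
    using quad_form_scalar_imp[of "{..<l}" "N u" "sq_norm_upto l u" a b] N_form N_sym ab by auto
  define M where "M = (\<lambda>i k. (B (i, a) (k, b) + B (k, a) (i, b)) / 2)"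
  have M_sym: "M i k = M k i" for i k
    by (simp add: M_def add.commute)
  have M_form: "quad_form {..<l} M u = (if a = b then 1 else 0) * sq_norm_upto l u" for u
  proof -
    have "quad_form {..<l} M u = (N u a b + (\<Sum>i<l. \<Sum>k<l. u i * u k * B (k, a) (i, b))) / 2"
      by (simp add: quad_form_def M_def N_def sum.distrib[symmetric] sum_divide_distrib
          algebra_simps add_divide_distrib)
    also have "(\<Sum>i<l. \<Sum>k<l. u i * u k * B (k, a) (i, b)) = N u a b"
      unfolding N_def by (subst sum.swap) (simp add: mult_ac)
    finally show ?thesis by (simp add: N_entry)
  qed
  have "M i k = (if i = k then (if a = b then 1 else 0) else 0)"
    by (rule quad_form_scalar_imp[OF _ M_sym M_form]) (use ik in auto)
  moreover have "B (k, a) (i, b) = B (i, b) (k, a)"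
    using sym ik ab by auto
  ultimately show ?thesis by (auto simp: M_def split: if_splits)
qed

text \<open>Let \<open>r\<^sub>a\<close> be the bilinear form with coefficients \<open>R i a j\<close>. Then \<open>B\<close> is the Gram matrix of all
  the bilinear forms in the identity
  \<open>\<bar>u\<bar>\<^sup>2 \<bar>v\<bar>\<^sup>2 = \<Sum>\<^sub>a r\<^sub>a(u, v)\<^sup>2 + \<Sum>\<^sub>t c\<^sub>t(u, v)\<^sup>2\<close>. The row condition comes from points where the
  first sum alone equals \<open>\<bar>u\<bar>\<^sup>2 \<bar>v\<bar>\<^sup>2\<close>: there every \<open>c\<^sub>t\<close> vanishes.\<close>

lemma gram_conditions_of_bilinear_squares:
  fixes R :: "nat \<Rightarrow> nat \<Rightarrow> nat \<Rightarrow> real" and c :: "'t \<Rightarrow> nat \<Rightarrow> nat \<Rightarrow> real"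
  assumes "finite T"
    and orth: "\<And>q a b. q < l \<Longrightarrow> a < m \<Longrightarrow> b < m \<Longrightarrow>
      (\<Sum>j<l. R q a j * R q b j) = (if a = b then 1 else 0)"
    and sos: "\<And>u v. biquadratic_gap l m R u v = (\<Sum>t\<in>T. (bilin_form l (c t) u v)^2)"
    and B_def: "\<And>p q. B p q = (\<Sum>a<m. R (fst p) a (snd p) * R (fst q) a (snd q))
      + (\<Sum>t\<in>T. c t (fst p) (snd p) * c t (fst q) (snd q))"
  shows "B p q = B q p" and "0 \<le> quad_form (pair_range l) B y"
    and "\<And>i k a b. \<lbrakk>i < l; k < l; a < l; b < l\<rbrakk> \<Longrightarrow>
      B (i, a) (k, b) + B (i, b) (k, a) = (if i = k \<and> a = b then 2 else 0)"
    and "\<And>i j a b. \<lbrakk>i < l; j < l; a < m; b < l\<rbrakk> \<Longrightarrow>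
      (\<Sum>x<l. R i a x * B (i, x) (j, b)) = R j a b"
proof -
  show sym: "B p q = B q p" for p q by (simp add: B_def mult_ac)
  have form: "quad_form (pair_range l) B y =
      (\<Sum>a<m. (\<Sum>p\<in>pair_range l. R (fst p) a (snd p) * y p)^2)
      + (\<Sum>t\<in>T. (\<Sum>p\<in>pair_range l. c t (fst p) (snd p) * y p)^2)" for y
  proof -
    have "quad_form (pair_range l) B y =
        quad_form (pair_range l) (\<lambda>p q. \<Sum>a<m. R (fst p) a (snd p) * R (fst q) a (snd q)) y
        + quad_form (pair_range l) (\<lambda>p q. \<Sum>t\<in>T. c t (fst p) (snd p) * c t (fst q) (snd q)) y"
      unfolding quad_form_def B_def by (simp only: sum.distrib[symmetric] distrib_right)
    also have "\<dots> = (\<Sum>a<m. (\<Sum>p\<in>pair_range l. R (fst p) a (snd p) * y p)^2)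
      + (\<Sum>t\<in>T. (\<Sum>p\<in>pair_range l. c t (fst p) (snd p) * y p)^2)"
      by (subst quad_form_gram, simp)+ simp
    finally show ?thesis .
  qed
  show "0 \<le> quad_form (pair_range l) B y"
    unfolding form by (intro add_nonneg_nonneg sum_nonneg) auto
  have tensor: "quad_form (pair_range l) B (\<lambda>p. u (fst p) * v (snd p))
      = sq_norm_upto l u * sq_norm_upto l v" for u v
    using sos[of u v] unfolding form by (simp add: bilin_form_eq_tensor case_prod_unfold)
  show "B (i, a) (k, b) + B (i, b) (k, a) = (if i = k \<and> a = b then 2 else 0)"
    if "i < l" "k < l" "a < l" "b < l" for i k a b
    using blocks_skew_of_quad_form[of l B, OF sym tensor] that by blast
  show "(\<Sum>x<l. R i a x * B (i, x) (j, b)) = R j a b"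
    if ij: "i < l" "j < l" and a: "a < m" and "b < l" for i j a b
  proof -
    \<comment> \<open>the gap vanishes at \<open>u = e\<^sub>i\<close>, \<open>v = R i a\<close>\<close>
    let ?e = "\<lambda>k. of_bool (k = i) :: real"
    have at_e: "bilin_form l d ?e v = (\<Sum>x<l. d i x * v x)" for d v
    proof -
      have "bilin_form l d ?e v = (\<Sum>k<l. if k = i then (\<Sum>x<l. d k x * v x) else 0)"
        unfolding bilin_form_def by (intro sum.cong) auto
      then show ?thesis using ij by simp
    qed
    have "sq_norm_upto l ?e = (\<Sum>k<l. if k = i then 1 else 0)"
      by (intro sum.cong) auto
    then have "sq_norm_upto l ?e = 1"
      using ij by simp
    moreover have "sq_norm_upto l (R i a) = 1"
      using orth[OF ij(1) a a] by (simp add: power2_eq_square)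
    moreover have "(\<Sum>f<m. (bilin_form l (\<lambda>i. R i f) ?e (R i a))^2) = 1"
    proof -
      have "(\<Sum>f<m. (bilin_form l (\<lambda>i. R i f) ?e (R i a))^2) = (\<Sum>f<m. if f = a then 1 else 0)"
        unfolding at_e using orth[OF ij(1) _ a] by (intro sum.cong) auto
      then show ?thesis using a by simp
    qed
    ultimately have "(\<Sum>t\<in>T. (bilin_form l (c t) ?e (R i a))^2) = 0"
      using sos[of ?e "R i a"] by simp
    then have zero: "(\<Sum>x<l. c t i x * R i a x) = 0" if "t \<in> T" for t
      using that \<open>finite T\<close> by (simp add: sum_nonneg_eq_0_iff at_e)
    have "(\<Sum>x<l. R i a x * B (i, x) (j, b))
        = (\<Sum>x<l. \<Sum>f<m. R i a x * R i f x * R j f b) + (\<Sum>x<l. \<Sum>t\<in>T. c t i x * R i a x * c t j b)"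
      by (simp add: B_def distrib_left sum.distrib sum_distrib_left mult_ac)
    also have "(\<Sum>x<l. \<Sum>f<m. R i a x * R i f x * R j f b) = (\<Sum>f<m. (\<Sum>x<l. R i a x * R i f x) * R j f b)"
      by (subst sum.swap) (simp add: sum_distrib_right)
    also have "\<dots> = (\<Sum>f<m. if a = f then R j f b else 0)"
      using orth[OF ij(1) a] by (intro sum.cong) auto
    also have "\<dots> = R j a b" using a by simp
    also have "(\<Sum>x<l. \<Sum>t\<in>T. c t i x * R i a x * c t j b) = (\<Sum>t\<in>T. (\<Sum>x<l. c t i x * R i a x) * c t j b)"
      by (subst sum.swap) (simp add: sum_distrib_right)
    also have "\<dots> = 0" using zero by simp
    finally show ?thesis by simp
  qed
qed

text \<open>The block row \<open>0\<close> alone already provides the preimages needed to subtract the squares of the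
  forms \<open>R\<close> from \<open>B\<close> and to stay positive semidefinite.\<close>

lemma bilinear_squares_of_gram_conditions:
  assumes "0 < l"
    and orth: "\<And>a b. a < m \<Longrightarrow> b < m \<Longrightarrow> (\<Sum>j<l. R 0 a j * R 0 b j) = (if a = b then 1 else 0)"
    and sym: "\<And>p q. p \<in> pair_range l \<Longrightarrow> q \<in> pair_range l \<Longrightarrow> B p q = B q p"
    and psd: "\<And>y. 0 \<le> quad_form (pair_range l) B y"
    and diag: "\<And>i a b. i < l \<Longrightarrow> a < l \<Longrightarrow> b < l \<Longrightarrow> B (i, a) (i, b) = (if a = b then 1 else 0)"
    and skew: "\<And>i k a b. i < l \<Longrightarrow> k < l \<Longrightarrow> i \<noteq> k \<Longrightarrow> a < l \<Longrightarrow> b < l \<Longrightarrow>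
      B (i, a) (k, b) = - B (i, b) (k, a)"
    and rows: "\<And>j a b. \<lbrakk>j < l; a < m; b < l\<rbrakk> \<Longrightarrow> (\<Sum>x<l. R 0 a x * B (0, x) (j, b)) = R j a b"
  shows "\<exists>(n::nat) c. \<forall>u v. biquadratic_gap l m R u v = (\<Sum>k<n. (bilin_form l (c k) u v)^2)"
proof -
  define \<rho> where "\<rho> = (\<lambda>a (p::nat \<times> nat). R (fst p) a (snd p))"
  \<comment> \<open>row \<open>a\<close> of the first \<open>R\<close>, placed in block \<open>0\<close> and extended by zero\<close>
  define r where "r = (\<lambda>a (p::nat \<times> nat). if fst p = 0 then R 0 a (snd p) else 0)"
  have first_block: "(\<Sum>p\<in>pair_range l. g p * r a p) = (\<Sum>x<l. g (0, x) * R 0 a x)" for g a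
  proof -
    have "(\<Sum>p\<in>pair_range l. g p * r a p) = (\<Sum>i<l. \<Sum>x<l. g (i, x) * r a (i, x))"
      by (simp add: sum.cartesian_product')
    also have "\<dots> = (\<Sum>i<l. if i = 0 then (\<Sum>x<l. g (i, x) * R 0 a x) else 0)"
      by (intro sum.cong) (auto simp: r_def)
    finally show ?thesis using \<open>0 < l\<close> by simp
  qed
  have image: "(\<Sum>q\<in>pair_range l. B p q * r a q) = \<rho> a p" if "a < m" "p \<in> pair_range l" for a p
  proof -
    have "(\<Sum>q\<in>pair_range l. B p q * r a q) = (\<Sum>x<l. R 0 a x * B (0, x) p)"
      unfolding first_block using that \<open>0 < l\<close> by (intro sum.cong refl) (auto simp: sym mult_ac)
    then show ?thesis using that rows by (auto simp: \<rho>_def)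
  qed
  have dual: "(\<Sum>p\<in>pair_range l. \<rho> a p * r b p) = (if a = b then 1 else 0)" if "a < m" "b < m" for a b
    unfolding first_block using orth that by (simp add: \<rho>_def)
  define M where "M = (\<lambda>p q. B p q - (\<Sum>a<m. \<rho> a p * \<rho> a q))"
  have M_form: "quad_form (pair_range l) M y
      = quad_form (pair_range l) B y - (\<Sum>a<m. (\<Sum>p\<in>pair_range l. \<rho> a p * y p)^2)" for y
  proof -
    have "quad_form (pair_range l) M y = quad_form (pair_range l) B y
        - quad_form (pair_range l) (\<lambda>p q. \<Sum>a<m. \<rho> a p * \<rho> a q) y"
      unfolding quad_form_def M_def by (simp only: sum_subtractf[symmetric] left_diff_distrib)
    then show ?thesis by (subst (asm) quad_form_gram) auto
  qed
  have "0 \<le> quad_form (pair_range l) M y" for y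
    unfolding M_form
    using psd_minus_gram[of "pair_range l" "{..<m}" B r \<rho> y] sym psd image dual by auto
  moreover have "M p q = M q p" if "p \<in> pair_range l" "q \<in> pair_range l" for p q
    using sym[OF that] by (simp add: M_def mult_ac)
  ultimately obtain n c where
    nc: "\<And>y. quad_form (pair_range l) M y = (\<Sum>k<(n::nat). (\<Sum>p\<in>pair_range l. c k p * y p)^2)"
    using psd_form_sum_of_squares[of "pair_range l" M] by blast
  have "biquadratic_gap l m R u v = (\<Sum>k<n. (bilin_form l (curry (c k)) u v)^2)" for u v
  proof -
    have "quad_form (pair_range l) B (\<lambda>p. u (fst p) * v (snd p))
        = sq_norm_upto l u * sq_norm_upto l v"
      using diag skew by (rule quad_form_blocks_skew)
    then have "biquadratic_gap l m R u v = quad_form (pair_range l) M (\<lambda>p. u (fst p) * v (snd p))"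
      unfolding M_form by (simp add: bilin_form_eq_tensor \<rho>_def case_prod_unfold)
    then show ?thesis
      unfolding nc by (simp add: bilin_form_eq_tensor case_prod_unfold curry_def)
  qed
  then show ?thesis by (intro exI[of _ n] exI[of _ "\<lambda>k. curry (c k)"]) blast
qed

section \<open>Polynomials of bilinear growth\<close>

text \<open>The bound at \<open>0\<close> removes the constant term; after division by \<open>s\<close> the absolute value is at
  most \<open>C\<close> for all \<open>s \<noteq> 0\<close>, whereas a nonconstant polynomial is unbounded.\<close>

lemma poly_linear_of_linear_growth:
  fixes p :: "real poly"
  assumes "\<And>s. \<bar>poly p s\<bar> \<le> C * \<bar>s\<bar>"
  shows "p = monom (coeff p 1) 1"
proof -
  obtain a b q where p: "p = pCons a (pCons b q)"
    by (metis pCons_cases)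
  have "a = 0" using assms[of 0] by (simp add: p)
  have q: "q = 0"
  proof (rule ccontr)
    assume "q \<noteq> 0"
    then obtain r where r: "\<And>z. r \<le> norm z \<Longrightarrow> C + 1 \<le> norm (poly (pCons b q) z)"
      using poly_infinity by metis
    define z where "z = max 1 r"
    have "z > 0" "r \<le> norm z" by (auto simp: z_def)
    have "z * \<bar>poly (pCons b q) z\<bar> \<le> z * C"
      using assms[of z] \<open>z > 0\<close> by (simp only: p \<open>a = 0\<close> poly_pCons[of 0] add_0_left abs_mult) (simp add: mult.commute)
    then have "\<bar>poly (pCons b q) z\<bar> \<le> C" using \<open>z > 0\<close> by simp
    with r[OF \<open>r \<le> norm z\<close>] show False by simp
  qed
  show ?thesis using \<open>a = 0\<close> q by (simp add: p monom_altdef)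
qed

lemma linear_part_of_linear_growth:
  fixes c :: "'k \<Rightarrow> real"
  assumes "finite K" and "\<And>s. \<bar>\<Sum>k\<in>K. c k * s ^ d k\<bar> \<le> C * \<bar>s\<bar>"
  shows "(\<Sum>k\<in>K. c k * s ^ d k) = s * (\<Sum>k | k \<in> K \<and> d k = 1. c k)"
proof -
  define p where "p = (\<Sum>k\<in>K. monom (c k) (d k))"
  have p: "poly p s = (\<Sum>k\<in>K. c k * s ^ d k)" for s
    by (simp add: p_def poly_sum poly_monom)
  have "p = monom (coeff p 1) 1"
    using assms(2) by (intro poly_linear_of_linear_growth[of _ C]) (simp add: p)
  then have "poly p s = coeff p 1 * s"
    by (metis poly_monom power_one_right)
  moreover have "coeff p 1 = (\<Sum>k | k \<in> K \<and> d k = 1. c k)"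
  proof -
    have "coeff p 1 = (\<Sum>k\<in>K. if d k = 1 then c k else 0)"
      unfolding p_def by (simp add: coeff_sum)
    also have "\<dots> = (\<Sum>k\<in>K \<inter> {k. d k = 1}. c k)"
      using assms(1) by (simp add: sum.If_cases)
    finally show ?thesis by (simp add: Int_def)
  qed
  ultimately show ?thesis by (simp add: p)
qed

text \<open>The terms are monomials in two scaling parameters \<open>s\<close> and \<open>t\<close>. For fixed \<open>t\<close> only degree one in \<open>s\<close>
  survives, and the surviving terms have linear growth in \<open>t\<close>. The identity is between the values at
  \<open>s = t = 1\<close>.\<close>

lemma bidegree_one_part_of_bilinear_growth:
  fixes c :: "'k \<Rightarrow> real"
  assumes "finite K" and bound: "\<And>s t. \<bar>\<Sum>k\<in>K. c k * s ^ d k * t ^ e k\<bar> \<le> C * \<bar>s\<bar> * \<bar>t\<bar>"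
  shows "(\<Sum>k\<in>K. c k) = (\<Sum>k | k \<in> K \<and> d k = 1 \<and> e k = 1. c k)"
proof -
  have s_part: "(\<Sum>k\<in>K. c k * t ^ e k) = (\<Sum>k | k \<in> K \<and> d k = 1. c k * t ^ e k)" for t
    using linear_part_of_linear_growth[of K "\<lambda>k. c k * t ^ e k" d "C * \<bar>t\<bar>" 1] assms
    by (simp add: mult_ac)
  have "\<bar>\<Sum>k | k \<in> K \<and> d k = 1. c k * t ^ e k\<bar> \<le> C * \<bar>t\<bar>" for t
    using bound[of 1 t] by (simp add: s_part)
  then have "(\<Sum>k | k \<in> K \<and> d k = 1. c k * 1 ^ e k)
      = 1 * (\<Sum>k | k \<in> {k. k \<in> K \<and> d k = 1} \<and> e k = 1. c k)"
    using assms(1) by (intro linear_part_of_linear_growth) auto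
  then show ?thesis using s_part[of 1] by (simp add: conj_assoc)
qed

definition pair_vec :: "nat \<Rightarrow> (nat \<Rightarrow> real) \<Rightarrow> (nat \<Rightarrow> real) \<Rightarrow> real vec" where
  "pair_vec l u v = vec l u @\<^sub>v vec l v"

lemma pair_vec_carrier [simp]: "pair_vec l u v \<in> carrier_vec (2 * l)"
  unfolding pair_vec_def mult_2 by simp

lemma pair_vec_index:
  "i < 2 * l \<Longrightarrow> pair_vec l u v $ i = (if i < l then u i else v (i - l))"
  by (simp add: pair_vec_def)

lemma carrier_vec_pair_vecE:
  assumes "x \<in> carrier_vec (2 * l)"
  obtains u v where "x = pair_vec l u v"
proof
  show "x = pair_vec l (\<lambda>i. x $ i) (\<lambda>i. x $ (l + i))"
    using assms by (intro eq_vecI) (auto simp: pair_vec_def)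
qed

lemma mpoly_eval_superset:
  assumes "finite K" "Poly_Mapping.keys p \<subseteq> K"
  shows "mpoly_eval p x = (\<Sum>\<mu>\<in>K. Poly_Mapping.lookup p \<mu> *
     (\<Prod>i\<in>Poly_Mapping.keys \<mu>. (x $ i) ^ Poly_Mapping.lookup \<mu> i))"
  unfolding mpoly_eval_def using assms
  by (intro sum.mono_neutral_left) (auto simp: in_keys_iff)

lemma mpoly_eval_0 [simp]: "mpoly_eval 0 x = 0"
  by (simp add: mpoly_eval_def)

lemma mpoly_eval_add: "mpoly_eval (p + q) x = mpoly_eval p x + mpoly_eval q x"
proof -
  let ?K = "Poly_Mapping.keys p \<union> Poly_Mapping.keys q"
  have "Poly_Mapping.keys (p + q) \<subseteq> ?K"
    by (rule Poly_Mapping.keys_add)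
  then show ?thesis
    using mpoly_eval_superset[of ?K p x] mpoly_eval_superset[of ?K q x]
      mpoly_eval_superset[of ?K "p + q" x]
    by (simp add: lookup_add distrib_right sum.distrib)
qed

lemma mpoly_eval_sum: "mpoly_eval (sum f I) x = (\<Sum>i\<in>I. mpoly_eval (f i) x)"
  by (induction I rule: infinite_finite_induct) (auto simp: mpoly_eval_add)

lemma mpoly_eval_single:
  "mpoly_eval (Poly_Mapping.single \<mu> a) x
    = a * (\<Prod>i\<in>Poly_Mapping.keys \<mu>. (x $ i) ^ Poly_Mapping.lookup \<mu> i)"
  by (simp add: mpoly_eval_def)

lemma mpolys_in_sum:
  assumes "\<And>i. i \<in> I \<Longrightarrow> f i \<in> mpolys_in n"
  shows "sum f I \<in> mpolys_in n"
  using assms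
proof (induction I rule: infinite_finite_induct)
  case (insert a I)
  have "Poly_Mapping.keys (f a + sum f I) \<subseteq> Poly_Mapping.keys (f a) \<union> Poly_Mapping.keys (sum f I)"
    by (rule Poly_Mapping.keys_add)
  moreover have "f a \<in> mpolys_in n" "sum f I \<in> mpolys_in n"
    using insert by auto
  ultimately show ?case
    using insert.hyps unfolding mpolys_in_def by auto
qed (auto simp: mpolys_in_def)

lemma ex_mpoly_bilin_form:
  "\<exists>p \<in> mpolys_in (2 * l). \<forall>u v. mpoly_eval p (pair_vec l u v) = bilin_form l c u v"
proof -
  define \<mu> where "\<mu> = (\<lambda>i j. Poly_Mapping.single i (1::nat) + Poly_Mapping.single (l + j) 1)"
  have keys: "Poly_Mapping.keys (\<mu> i j) = {i, l + j}" if "i < l" for i j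
    using that by (auto simp: \<mu>_def in_keys_iff lookup_add lookup_single when_def split: if_splits)
  define p where "p = (\<Sum>i<l. \<Sum>j<l. Poly_Mapping.single (\<mu> i j) (c i j))"
  have "p \<in> mpolys_in (2 * l)"
    unfolding p_def by (intro mpolys_in_sum) (auto simp: mpolys_in_def keys)
  moreover have "mpoly_eval p (pair_vec l u v) = bilin_form l c u v" for u v
  proof -
    have "(\<Prod>k\<in>Poly_Mapping.keys (\<mu> i j). (pair_vec l u v $ k) ^ Poly_Mapping.lookup (\<mu> i j) k)
        = u i * v j" if "i < l" "j < l" for i j
      using that by (simp add: keys pair_vec_index) (simp add: \<mu>_def lookup_add lookup_single when_def)
    then show ?thesis
      by (simp add: p_def mpoly_eval_sum mpoly_eval_single bilin_form_def mult.assoc)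
  qed
  ultimately show ?thesis by blast
qed

text \<open>The value of the monomial \<open>\<mu>\<close> in \<open>2 * l\<close> variables at the point \<open>(u, v)\<close>, with the variables split
  into the two halves so that its degrees in \<open>u\<close> and in \<open>v\<close> can be read off separately.\<close>

definition pair_monomial :: "nat \<Rightarrow> (nat \<Rightarrow>\<^sub>0 nat) \<Rightarrow> (nat \<Rightarrow> real) \<Rightarrow> (nat \<Rightarrow> real) \<Rightarrow> real" where
  "pair_monomial l \<mu> u v =
     (\<Prod>i\<in>Poly_Mapping.keys \<mu> \<inter> {..<l}. u i ^ Poly_Mapping.lookup \<mu> i) *
     (\<Prod>i\<in>Poly_Mapping.keys \<mu> - {..<l}. v (i - l) ^ Poly_Mapping.lookup \<mu> i)"

definition deg_left :: "nat \<Rightarrow> (nat \<Rightarrow>\<^sub>0 nat) \<Rightarrow> nat" where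
  "deg_left l \<mu> = (\<Sum>i\<in>Poly_Mapping.keys \<mu> \<inter> {..<l}. Poly_Mapping.lookup \<mu> i)"

definition deg_right :: "nat \<Rightarrow> (nat \<Rightarrow>\<^sub>0 nat) \<Rightarrow> nat" where
  "deg_right l \<mu> = (\<Sum>i\<in>Poly_Mapping.keys \<mu> - {..<l}. Poly_Mapping.lookup \<mu> i)"

lemma mpoly_eval_pair_vec:
  assumes "p \<in> mpolys_in (2 * l)"
  shows "mpoly_eval p (pair_vec l u v)
    = (\<Sum>\<mu>\<in>Poly_Mapping.keys p. Poly_Mapping.lookup p \<mu> * pair_monomial l \<mu> u v)"
  unfolding mpoly_eval_def
proof (rule sum.cong[OF refl])
  fix \<mu> assume "\<mu> \<in> Poly_Mapping.keys p"
  then have sub: "Poly_Mapping.keys \<mu> \<subseteq> {..<2 * l}"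
    using assms by (auto simp: mpolys_in_def)
  have "(\<Prod>i\<in>Poly_Mapping.keys \<mu>. (pair_vec l u v $ i) ^ Poly_Mapping.lookup \<mu> i)
      = (\<Prod>i\<in>Poly_Mapping.keys \<mu> \<inter> {..<l}. (pair_vec l u v $ i) ^ Poly_Mapping.lookup \<mu> i) *
        (\<Prod>i\<in>Poly_Mapping.keys \<mu> - {..<l}. (pair_vec l u v $ i) ^ Poly_Mapping.lookup \<mu> i)"
    by (rule prod.Int_Diff) simp
  also have "\<dots> = pair_monomial l \<mu> u v"
    unfolding pair_monomial_def using sub
    by (intro arg_cong2[where f = "(*)"] prod.cong refl) (auto simp: pair_vec_index subset_eq)
  finally show "Poly_Mapping.lookup p \<mu> *
      (\<Prod>i\<in>Poly_Mapping.keys \<mu>. (pair_vec l u v $ i) ^ Poly_Mapping.lookup \<mu> i)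
      = Poly_Mapping.lookup p \<mu> * pair_monomial l \<mu> u v" by simp
qed

lemma pair_monomial_scale:
  "pair_monomial l \<mu> (\<lambda>i. s * u i) (\<lambda>i. t * v i)
    = pair_monomial l \<mu> u v * s ^ deg_left l \<mu> * t ^ deg_right l \<mu>"
  by (simp add: pair_monomial_def deg_left_def deg_right_def power_mult_distrib prod.distrib power_sum mult_ac)

lemma pair_monomial_bidegree_one:
  assumes "Poly_Mapping.keys \<mu> \<subseteq> {..<2 * l}" "deg_left l \<mu> = 1" "deg_right l \<mu> = 1"
  shows "\<exists>i j. i < l \<and> j < l \<and> (\<forall>u v. pair_monomial l \<mu> u v = u i * v j)"
proof -
  have singleton: "\<exists>a. A = {a} \<and> Poly_Mapping.lookup \<mu> a = 1"
    if A: "A \<subseteq> Poly_Mapping.keys \<mu>" and sum: "(\<Sum>i\<in>A. Poly_Mapping.lookup \<mu> i) = 1" for A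
  proof -
    have "finite A" using A finite_keys finite_subset by blast
    with sum obtain a where a: "a \<in> A" "Poly_Mapping.lookup \<mu> a = 1"
      "\<forall>b\<in>A. a \<noteq> b \<longrightarrow> Poly_Mapping.lookup \<mu> b = 0"
      using sum_eq_1_iff by meson
    have "b = a" if "b \<in> A" for b
    proof (rule ccontr)
      assume "b \<noteq> a"
      with a(3) that have "Poly_Mapping.lookup \<mu> b = 0" by auto
      moreover have "b \<in> Poly_Mapping.keys \<mu>" using A that by blast
      ultimately show False by (simp add: in_keys_iff)
    qed
    then show ?thesis using a by blast
  qed
  obtain a where a: "Poly_Mapping.keys \<mu> \<inter> {..<l} = {a}" "Poly_Mapping.lookup \<mu> a = 1"
    using singleton[of "Poly_Mapping.keys \<mu> \<inter> {..<l}"] assms(2) by (auto simp: deg_left_def)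
  obtain b where b: "Poly_Mapping.keys \<mu> - {..<l} = {b}" "Poly_Mapping.lookup \<mu> b = 1"
    using singleton[of "Poly_Mapping.keys \<mu> - {..<l}"] assms(3) by (auto simp: deg_right_def)
  have "a < l" using a(1) by auto
  moreover have "b \<ge> l" "b < 2 * l" using b(1) assms(1) by auto
  then have "b - l < l" by simp
  moreover have "pair_monomial l \<mu> u v = u a * v (b - l)" for u v
    unfolding pair_monomial_def a(1) b(1) by (simp add: a b)
  ultimately show ?thesis by blast
qed

text \<open>Replacing \<open>(u, v)\<close> by \<open>(s u, t v)\<close> turns the polynomial into one in \<open>s\<close> and \<open>t\<close> of growth
  \<open>\<bar>s\<bar> \<bar>t\<bar>\<close>, so only the monomials of degree one in \<open>u\<close> and in \<open>v\<close> contribute, and each of them is a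
  product \<open>u\<^sub>i v\<^sub>j\<close>.\<close>

lemma mpoly_bilin_form_of_growth:
  assumes p: "p \<in> mpolys_in (2 * l)"
    and bound: "\<And>u v. (mpoly_eval p (pair_vec l u v))^2 \<le> K * (sq_norm_upto l u * sq_norm_upto l v)"
  shows "\<exists>c. \<forall>u v. mpoly_eval p (pair_vec l u v) = bilin_form l c u v"
proof -
  define S where "S = {\<mu> \<in> Poly_Mapping.keys p. deg_left l \<mu> = 1 \<and> deg_right l \<mu> = 1}"
  have "finite S" by (simp add: S_def)
  have part: "mpoly_eval p (pair_vec l u v)
      = (\<Sum>\<mu>\<in>S. Poly_Mapping.lookup p \<mu> * pair_monomial l \<mu> u v)" for u v
  proof -
    let ?C = "sqrt (K * (sq_norm_upto l u * sq_norm_upto l v))"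
    have growth: "\<bar>\<Sum>\<mu>\<in>Poly_Mapping.keys p. (Poly_Mapping.lookup p \<mu> * pair_monomial l \<mu> u v)
        * s ^ deg_left l \<mu> * t ^ deg_right l \<mu>\<bar> \<le> ?C * \<bar>s\<bar> * \<bar>t\<bar>" for s t
    proof -
      let ?y = "mpoly_eval p (pair_vec l (\<lambda>i. s * u i) (\<lambda>i. t * v i))"
      have "sq_norm_upto l (\<lambda>i. s * u i) * sq_norm_upto l (\<lambda>i. t * v i)
          = (sq_norm_upto l u * sq_norm_upto l v) * s^2 * t^2"
        by (simp add: power_mult_distrib flip: sum_distrib_left)
      then have "?y^2 \<le> (K * (sq_norm_upto l u * sq_norm_upto l v)) * s^2 * t^2"
        using bound[of "\<lambda>i. s * u i" "\<lambda>i. t * v i"] by (simp add: mult_ac)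
      then have "\<bar>?y\<bar> \<le> sqrt ((K * (sq_norm_upto l u * sq_norm_upto l v)) * s^2 * t^2)"
        by (intro real_le_rsqrt) simp
      also have "\<dots> = ?C * \<bar>s\<bar> * \<bar>t\<bar>"
        by (simp add: real_sqrt_mult)
      finally show ?thesis
        by (simp add: mpoly_eval_pair_vec[OF p] pair_monomial_scale mult.assoc)
    qed
    show ?thesis
      unfolding mpoly_eval_pair_vec[OF p] S_def
      by (rule bidegree_one_part_of_bilinear_growth[OF _ growth]) simp
  qed
  have "\<forall>\<mu>\<in>S. \<exists>ij. ij \<in> pair_range l \<and>
      (\<forall>u v. pair_monomial l \<mu> u v = u (fst ij) * v (snd ij))"
  proof
    fix \<mu> assume "\<mu> \<in> S"
    then have "Poly_Mapping.keys \<mu> \<subseteq> {..<2 * l}" "deg_left l \<mu> = 1" "deg_right l \<mu> = 1"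
      using p by (auto simp: S_def mpolys_in_def)
    from pair_monomial_bidegree_one[OF this] show "\<exists>ij. ij \<in> pair_range l \<and>
      (\<forall>u v. pair_monomial l \<mu> u v = u (fst ij) * v (snd ij))" by force
  qed
  then obtain g where g: "\<And>\<mu>. \<mu> \<in> S \<Longrightarrow> g \<mu> \<in> pair_range l"
    "\<And>\<mu> u v. \<mu> \<in> S \<Longrightarrow> pair_monomial l \<mu> u v = u (fst (g \<mu>)) * v (snd (g \<mu>))"
    by metis
  \<comment> \<open>collects all monomials that give the same product \<open>u\<^sub>i v\<^sub>j\<close>\<close>
  define c where "c = (\<lambda>i j. \<Sum>\<mu> | \<mu> \<in> S \<and> g \<mu> = (i, j). Poly_Mapping.lookup p \<mu>)"
  have "mpoly_eval p (pair_vec l u v) = bilin_form l c u v" for u v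
  proof -
    have "mpoly_eval p (pair_vec l u v)
        = (\<Sum>ij\<in>pair_range l. \<Sum>\<mu> | \<mu> \<in> S \<and> g \<mu> = ij.
            Poly_Mapping.lookup p \<mu> * pair_monomial l \<mu> u v)"
      unfolding part
      by (rule sum.group[symmetric]) (use \<open>finite S\<close> g(1) in \<open>simp, simp, blast\<close>)
    also have "\<dots> = (\<Sum>ij\<in>pair_range l. case_prod c ij * (u (fst ij) * v (snd ij)))"
    proof (rule sum.cong[OF refl])
      fix ij
      show "(\<Sum>\<mu> | \<mu> \<in> S \<and> g \<mu> = ij. Poly_Mapping.lookup p \<mu> * pair_monomial l \<mu> u v)
          = case_prod c ij * (u (fst ij) * v (snd ij))"
        unfolding c_def case_prod_unfold sum_distrib_right prod.collapse
        by (rule sum.cong[OF refl]) (use g(2) in auto)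
    qed
    finally show ?thesis by (simp add: bilin_form_eq_tensor)
  qed
  then show ?thesis by blast
qed

section \<open>The polynomial of a Clifford system in normal form\<close>

text \<open>The family \<open>E\<close> with the convention \<open>E\<^sub>0 = I\<close>.\<close>

abbreviation normal_form_unit :: "nat \<Rightarrow> (nat \<Rightarrow> real mat) \<Rightarrow> nat \<Rightarrow> real mat" where
  "normal_form_unit l E a \<equiv> (if a = 0 then 1\<^sub>m l else E a)"

lemma skew_entry:
  assumes "clifford_normal_form l m P E" "a < m" "a \<noteq> 0" "i < l" "j < l"
  shows "E a $$ (i, j) = - E a $$ (j, i)"
proof -
  have c: "E a \<in> carrier_mat l l" and t: "transpose_mat (E a) = - E a"
    using assms(1-3) by (auto simp: clifford_normal_form_def)
  have "transpose_mat (E a) $$ (j, i) = E a $$ (i, j)"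
    using c assms(4,5) by auto
  moreover have "(- E a) $$ (j, i) = - E a $$ (j, i)"
    using c assms(4,5) by auto
  ultimately show ?thesis using t by simp
qed

text \<open>The sum is the entry \<open>(q, q)\<close> of \<open>E\<^sub>a E\<^sub>b\<^sup>T\<close>, which for \<open>a, b \<ge> 1\<close> is skew-symmetric by
  the anticommutation relation if \<open>a \<noteq> b\<close>, so its diagonal vanishes, and is the identity if
  \<open>a = b\<close>. If \<open>a = 0\<close> or \<open>b = 0\<close>, the product reduces to the identity or to a skew-symmetric
  matrix.\<close>

lemma normal_form_rows_orthonormal:
  assumes nf: "clifford_normal_form l m P E" and q: "q < l" and ab: "a < m" "b < m"
  shows "(\<Sum>j<l. normal_form_unit l E a $$ (q, j) * normal_form_unit l E b $$ (q, j))
    = (if a = b then 1 else 0)"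
proof -
  have unit_row: "(\<Sum>j<l. 1\<^sub>m l $$ (q, j) * f j) = f q" for f :: "nat \<Rightarrow> real"
  proof -
    have "(\<Sum>j<l. 1\<^sub>m l $$ (q, j) * f j) = (\<Sum>j<l. if q = j then f j else 0)"
      using q by (intro sum.cong) auto
    then show ?thesis using q by simp
  qed
  have diag0: "E c $$ (q, q) = 0" if "c < m" "c \<noteq> 0" for c
    using skew_entry[OF nf that q q] by simp
  have unit_case: "(\<Sum>j<l. 1\<^sub>m l $$ (q, j) * normal_form_unit l E c $$ (q, j))
      = (if c = 0 then 1 else 0)" if "c < m" for c
    unfolding unit_row using q diag0[OF that] by auto
  show ?thesis
  proof (cases "a = 0 \<or> b = 0")
    case True
    then show ?thesis
    proof
      assume "a = 0"
      with unit_case[OF ab(2)] show ?thesis by auto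
    next
      assume "b = 0"
      with unit_case[OF ab(1)] show ?thesis by (auto simp: mult.commute)
    qed
  next
    case False
    have c: "E a \<in> carrier_mat l l" "E b \<in> carrier_mat l l"
      using nf False ab by (auto simp: clifford_normal_form_def)
    have "E a * E b + E b * E a = (if a = b then - 2 else 0) \<cdot>\<^sub>m 1\<^sub>m l"
      using nf False ab by (auto simp: clifford_normal_form_def)
    then have "(E a * E b + E b * E a) $$ (q, q) = (if a = b then - 2 else 0)"
      using q by simp
    moreover have "(E a * E b + E b * E a) $$ (q, q) = (E a * E b) $$ (q, q) + (E b * E a) $$ (q, q)"
      using c q by (intro index_add_mat(1)) auto
    moreover have diag: "(E x * E y) $$ (q, q) = - (\<Sum>j<l. E x $$ (q, j) * E y $$ (q, j))"
      if "x \<in> {a, b}" "y \<in> {a, b}" for x y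
    proof -
      have "E x \<in> carrier_mat l l" "E y \<in> carrier_mat l l" "y < m" "y \<noteq> 0"
        using c that ab False by auto
      then have "(E x * E y) $$ (q, q) = (\<Sum>j<l. E x $$ (q, j) * E y $$ (j, q))"
        using q by (simp add: scalar_prod_def lessThan_atLeast0)
      also have "\<dots> = (\<Sum>j<l. - (E x $$ (q, j) * E y $$ (q, j)))"
        using skew_entry[OF nf \<open>y < m\<close> \<open>y \<noteq> 0\<close> _ q] by (intro sum.cong refl) simp
      finally show ?thesis by (simp add: sum_negf)
    qed
    have "(E a * E b) $$ (q, q) = - (\<Sum>j<l. E a $$ (q, j) * E b $$ (q, j))"
      by (rule diag) auto
    moreover have "(E b * E a) $$ (q, q) = - (\<Sum>j<l. E a $$ (q, j) * E b $$ (q, j))"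
      by (subst diag) (auto simp: mult.commute)
    ultimately have "(\<Sum>j<l. E a $$ (q, j) * E b $$ (q, j)) = (if a = b then 1 else 0)"
      by (simp only:) (simp split: if_splits)
    then show ?thesis using False by simp
  qed
qed

lemma scalar_prod_pair_vec:
  "pair_vec l u v \<bullet> pair_vec l u v = sq_norm_upto l u + sq_norm_upto l v"
  unfolding pair_vec_def
  by (subst scalar_prod_append[of _ l _ l]) (auto simp: scalar_prod_def power2_eq_square lessThan_atLeast0)

lemma mult_mat_vec_scalar_prod:
  assumes "X \<in> carrier_mat l l"
  shows "(X *\<^sub>v vec l v) \<bullet> vec l u = bilin_form l (\<lambda>i j. X $$ (i, j)) u v"
  using assms
  by (simp add: scalar_prod_def bilin_form_def lessThan_atLeast0 sum_distrib_left sum_distrib_right mult_ac)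

lemma antidiagonal_block_form:
  assumes X: "X \<in> carrier_mat l l" and Y: "Y \<in> carrier_mat l l"
  shows "(four_block_mat (0\<^sub>m l l) X Y (0\<^sub>m l l) *\<^sub>v pair_vec l u v) \<bullet> pair_vec l u v
    = bilin_form l (\<lambda>i j. X $$ (i, j)) u v + bilin_form l (\<lambda>i j. Y $$ (i, j)) v u"
proof -
  have "four_block_mat (0\<^sub>m l l) X Y (0\<^sub>m l l) *\<^sub>v pair_vec l u v
      = (X *\<^sub>v vec l v) @\<^sub>v (Y *\<^sub>v vec l u)"
    unfolding pair_vec_def using X Y
    by (subst four_block_mat_mult_vec[of _ l l _ l _ l]) auto
  then show ?thesis
    unfolding pair_vec_def using X Y
    by (simp only:) (subst scalar_prod_append[of _ l _ l], auto simp: mult_mat_vec_scalar_prod)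
qed

text \<open>The form of \<open>P\<^sub>0\<close> is \<open>\<bar>u\<bar>\<^sup>2 - \<bar>v\<bar>\<^sup>2\<close>, which turns \<open>(\<bar>u\<bar>\<^sup>2 + \<bar>v\<bar>\<^sup>2)\<^sup>2\<close> into \<open>4 \<bar>u\<bar>\<^sup>2 \<bar>v\<bar>\<^sup>2\<close>. In the other forms the two
  off-diagonal blocks contribute equally, as both are \<open>I\<close> or as \<open>E\<^sub>a\<close> is skew-symmetric.\<close>

lemma G_F_pair_vec:
  assumes "m \<ge> 1" and nf: "clifford_normal_form l m P E"
  shows "G_F m P (pair_vec l u v)
    = 4 * biquadratic_gap l m (\<lambda>q a j. normal_form_unit l E a $$ (q, j)) u v"
proof -
  let ?x = "pair_vec l u v"
  let ?\<beta> = "\<lambda>a. bilin_form l (\<lambda>q j. normal_form_unit l E a $$ (q, j)) u v"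
  have P0: "(P 0 *\<^sub>v ?x) \<bullet> ?x = sq_norm_upto l u - sq_norm_upto l v"
  proof -
    have "P 0 *\<^sub>v ?x = (1\<^sub>m l *\<^sub>v vec l u) @\<^sub>v (- 1\<^sub>m l *\<^sub>v vec l v)"
      using nf unfolding pair_vec_def clifford_normal_form_def
      by (simp only:) (rule mult_mat_vec_split, auto)
    also have "\<dots> = vec l u @\<^sub>v - vec l v" by simp
    finally show ?thesis
      unfolding pair_vec_def
      by (simp only:) (subst scalar_prod_append[of _ l _ l],
        auto simp: scalar_prod_def power2_eq_square lessThan_atLeast0 sum_negf)
  qed
  have PSuc: "(P (Suc a) *\<^sub>v ?x) \<bullet> ?x = 2 * ?\<beta> a" if "a < m" for a
  proof (cases "a = 0")
    case True
    have "bilin_form l (\<lambda>i j. 1\<^sub>m l $$ (i, j)) v u = bilin_form l (\<lambda>i j. 1\<^sub>m l $$ (i, j)) u v"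
      unfolding bilin_form_def by (subst sum.swap) (auto intro!: sum.cong)
    moreover have "P (Suc a) = four_block_mat (0\<^sub>m l l) (1\<^sub>m l) (1\<^sub>m l) (0\<^sub>m l l)"
      using nf True by (simp add: clifford_normal_form_def)
    ultimately show ?thesis using True by (simp add: antidiagonal_block_form)
  next
    case False
    have c: "E a \<in> carrier_mat l l"
      and P: "P (Suc a) = four_block_mat (0\<^sub>m l l) (E a) (- E a) (0\<^sub>m l l)"
      using nf False that by (auto simp: clifford_normal_form_def)
    have "(- E a) $$ (j, i) = E a $$ (i, j)" if "i < l" "j < l" for i j
      using c that skew_entry[OF nf \<open>a < m\<close> False that] by simp
    then have "bilin_form l (\<lambda>i j. (- E a) $$ (i, j)) v u = bilin_form l (\<lambda>i j. E a $$ (i, j)) u v"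
      unfolding bilin_form_def
      by (subst sum.swap, intro sum.cong[OF refl]) (simp only: lessThan_iff, simp)
    then show ?thesis
      using c P False by (simp add: antidiagonal_block_form)
  qed
  have "(\<Sum>\<alpha>\<le>m. ((P \<alpha> *\<^sub>v ?x) \<bullet> ?x)^2)
      = (sq_norm_upto l u - sq_norm_upto l v)^2 + (\<Sum>a<m. (2 * ?\<beta> a)^2)"
    unfolding lessThan_Suc_atMost[symmetric] sum.lessThan_Suc_shift using P0 PSuc by simp
  then show ?thesis
    by (simp add: G_F_def scalar_prod_pair_vec power2_eq_square algebra_simps flip: sum_distrib_left)
qed

text \<open>Every polynomial in a sum-of-squares representation of \<open>G\<^sub>F\<close> is automatically bilinear, since its
  square is dominated by \<open>4 \<bar>u\<bar>\<^sup>2 \<bar>v\<bar>\<^sup>2\<close>. The factor \<open>4\<close> is absorbed by scaling the forms by \<open>2\<close>.\<close>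

lemma sum_of_squares_G_F_iff:
  assumes "m \<ge> 1" and nf: "clifford_normal_form l m P E"
  shows "sum_of_squares_of_polys (2 * l) (G_F m P) \<longleftrightarrow>
    (\<exists>(r::nat) c. \<forall>u v. biquadratic_gap l m (\<lambda>q a j. normal_form_unit l E a $$ (q, j)) u v
      = (\<Sum>k<r. (bilin_form l (c k) u v)^2))" (is "?sos \<longleftrightarrow> ?bil")
proof
  let ?R = "\<lambda>q a j. normal_form_unit l E a $$ (q, j)"
  note G = G_F_pair_vec[OF assms]
  have scale: "bilin_form l (\<lambda>i j. s * d i j) u v = s * bilin_form l d u v" for s d u v
    by (simp add: bilin_form_def sum_distrib_left mult_ac)
  {
    assume ?sos
    then obtain r q where q: "\<And>k. k < (r::nat) \<Longrightarrow> q k \<in> mpolys_in (2 * l)"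
      and eq: "\<And>x. x \<in> carrier_vec (2 * l) \<Longrightarrow> G_F m P x = (\<Sum>k<r. (mpoly_eval (q k) x)^2)"
      unfolding sum_of_squares_of_polys_def by blast
    have "\<exists>c. \<forall>u v. mpoly_eval (q k) (pair_vec l u v) = bilin_form l c u v" if k: "k < r" for k
    proof (rule mpoly_bilin_form_of_growth[OF q[OF k], where K = 4])
      fix u v
      have "(mpoly_eval (q k) (pair_vec l u v))^2 \<le> (\<Sum>k<r. (mpoly_eval (q k) (pair_vec l u v))^2)"
        using k by (intro member_le_sum) auto
      also have "\<dots> = 4 * biquadratic_gap l m ?R u v"
        using eq[of "pair_vec l u v"] G[of u v] by simp
      also have "\<dots> \<le> 4 * (sq_norm_upto l u * sq_norm_upto l v)"
        by (simp add: sum_nonneg)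
      finally show "(mpoly_eval (q k) (pair_vec l u v))^2 \<le> 4 * (sq_norm_upto l u * sq_norm_upto l v)" .
    qed
    then obtain c where c: "\<And>k u v. k < r \<Longrightarrow> mpoly_eval (q k) (pair_vec l u v) = bilin_form l (c k) u v"
      by metis
    have "biquadratic_gap l m ?R u v = (\<Sum>k<r. (bilin_form l (\<lambda>i j. 1 / 2 * c k i j) u v)^2)" for u v
    proof -
      have "4 * biquadratic_gap l m ?R u v = (\<Sum>k<r. (bilin_form l (c k) u v)^2)"
        using eq[of "pair_vec l u v"] G[of u v] c by simp
      then show ?thesis
        unfolding scale power_mult_distrib sum_distrib_left[symmetric] by (simp add: power2_eq_square)
    qed
    then show ?bil
      by (intro exI[of _ r] exI[of _ "\<lambda>k i j. 1 / 2 * c k i j"]) blast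
  }
  {
    assume ?bil
    then obtain r c where
      rc: "\<And>u v. biquadratic_gap l m ?R u v = (\<Sum>k<(r::nat). (bilin_form l (c k) u v)^2)"
      by blast
    have "\<forall>k. \<exists>p. p \<in> mpolys_in (2 * l) \<and>
        (\<forall>u v. mpoly_eval p (pair_vec l u v) = bilin_form l (\<lambda>i j. 2 * c k i j) u v)"
      using ex_mpoly_bilin_form by blast
    then obtain q where q: "\<And>k. q k \<in> mpolys_in (2 * l)"
      "\<And>k u v. mpoly_eval (q k) (pair_vec l u v) = bilin_form l (\<lambda>i j. 2 * c k i j) u v"
      by metis
    have "G_F m P x = (\<Sum>k<r. (mpoly_eval (q k) x)^2)" if "x \<in> carrier_vec (2 * l)" for x
    proof -
      from that obtain u v where x: "x = pair_vec l u v" by (rule carrier_vec_pair_vecE)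
      show ?thesis
        unfolding x G rc q(2) scale power_mult_distrib sum_distrib_left[symmetric] by simp
    qed
    then show ?sos
      unfolding sum_of_squares_of_polys_def using q(1) by blast
  }
qed

section \<open>Matrices of size \<open>l\<^sup>2\<close> as functions on pairs\<close>

text \<open>The position of the basis vector \<open>e\<^sub>i \<otimes> e\<^sub>a\<close> of \<open>\<real>\<^sup>l \<otimes> \<real>\<^sup>l\<close> in the \<open>l\<^sup>2\<close> coordinates, matching the block
  layout of \<open>mat_block\<close>. It lets the matrix \<open>B\<close> be handled as a function on pairs.\<close>

definition tensor_index :: "nat \<Rightarrow> nat \<times> nat \<Rightarrow> nat" where
  "tensor_index l p = fst p * l + snd p"

lemma bij_betw_tensor_index: "bij_betw (tensor_index l) (pair_range l) {..<l^2}"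
proof (rule bij_betw_byWitness[where f' = "\<lambda>n. (n div l, n mod l)"])
  have "i * l + a < l * l" if "i < l" "a < l" for i a
  proof -
    have "i * l + a < Suc i * l" using that by simp
    also have "\<dots> \<le> l * l" using that by (intro mult_right_mono) auto
    finally show ?thesis .
  qed
  then show "tensor_index l ` pair_range l \<subseteq> {..<l^2}"
    by (auto simp: tensor_index_def power2_eq_square)
  show "(\<lambda>n. (n div l, n mod l)) ` {..<l^2} \<subseteq> pair_range l"
    by (auto simp: power2_eq_square less_mult_imp_div_less)
       (metis less_nat_zero_code mod_less_divisor mult_is_0 not_gr_zero)
qed (auto simp: tensor_index_def)

lemma quad_form_reindex:
  assumes "bij_betw f I J"
  shows "quad_form J A y = quad_form I (\<lambda>p q. A (f p) (f q)) (\<lambda>p. y (f p))"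
  unfolding quad_form_def by (simp add: sum.reindex_bij_betw[OF assms, symmetric])

lemma pos_semidef_iff_quad_form:
  assumes B: "B \<in> carrier_mat (l^2) (l^2)"
  defines "b \<equiv> (\<lambda>p q. B $$ (tensor_index l p, tensor_index l q))"
  shows "pos_semidef (l^2) B \<longleftrightarrow>
    (\<forall>p\<in>pair_range l. \<forall>q\<in>pair_range l. b p q = b q p) \<and> (\<forall>y. 0 \<le> quad_form (pair_range l) b y)"
proof -
  let ?n = "l^2"
  note bij = bij_betw_tensor_index[of l]
  have "transpose_mat B = B \<longleftrightarrow> (\<forall>i<?n. \<forall>j<?n. B $$ (i, j) = B $$ (j, i))"
    using B by (auto simp: mat_eq_iff)
  also have "\<dots> \<longleftrightarrow> (\<forall>i\<in>{..<?n}. \<forall>j\<in>{..<?n}. B $$ (i, j) = B $$ (j, i))" by auto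
  also have "\<dots> \<longleftrightarrow> (\<forall>p\<in>pair_range l. \<forall>q\<in>pair_range l. b p q = b q p)"
    unfolding b_def bij_betw_imp_surj_on[OF bij, symmetric] by blast
  finally have sym: "transpose_mat B = B \<longleftrightarrow> (\<forall>p\<in>pair_range l. \<forall>q\<in>pair_range l. b p q = b q p)" .
  have form: "v \<bullet> (B *\<^sub>v v) = quad_form (pair_range l) b (\<lambda>p. v $ tensor_index l p)"
    if "v \<in> carrier_vec ?n" for v
  proof -
    have "v \<bullet> (B *\<^sub>v v) = quad_form {..<?n} (\<lambda>i j. B $$ (i, j)) (\<lambda>i. v $ i)"
      using B that
      by (simp add: quad_form_def scalar_prod_def lessThan_atLeast0 sum_distrib_left mult_ac)
    then show ?thesis
      unfolding quad_form_reindex[OF bij] b_def .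
  qed
  have "(\<forall>v\<in>carrier_vec ?n. 0 \<le> v \<bullet> (B *\<^sub>v v)) \<longleftrightarrow> (\<forall>y. 0 \<le> quad_form (pair_range l) b y)"
  proof (intro iffI allI ballI)
    fix y :: "nat \<times> nat \<Rightarrow> real"
    assume nonneg: "\<forall>v\<in>carrier_vec ?n. 0 \<le> v \<bullet> (B *\<^sub>v v)"
    define v where "v = vec ?n (\<lambda>n. y (the_inv_into (pair_range l) (tensor_index l) n))"
    have "v $ tensor_index l p = y p" if "p \<in> pair_range l" for p
      using bij that bij_betwE[OF bij] by (auto simp: v_def bij_betw_def the_inv_into_f_f)
    then have "quad_form (pair_range l) b y = v \<bullet> (B *\<^sub>v v)"
      by (subst form) (auto simp: v_def intro!: quad_form_cong)
    then show "0 \<le> quad_form (pair_range l) b y" using nonneg by (simp add: v_def)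
  qed (simp add: form)
  then show ?thesis using B sym by (simp add: pos_semidef_def)
qed

lemma mat_block_eq_one_iff:
  "mat_block l B i k = 1\<^sub>m l \<longleftrightarrow> (\<forall>a<l. \<forall>b<l.
     B $$ (tensor_index l (i, a), tensor_index l (k, b)) = (if a = b then 1 else 0))"
  by (auto simp: mat_eq_iff mat_block_def tensor_index_def)

lemma mat_block_skew_iff:
  "mat_block l B i k = - transpose_mat (mat_block l B i k) \<longleftrightarrow> (\<forall>a<l. \<forall>b<l.
     B $$ (tensor_index l (i, a), tensor_index l (k, b))
       = - B $$ (tensor_index l (i, b), tensor_index l (k, a)))"
  by (auto simp: mat_eq_iff mat_block_def tensor_index_def)

lemma row_matrix_mult_block_iff:
  "row_matrix l m E i * mat_block l B i j = row_matrix l m E j \<longleftrightarrow> (\<forall>a<m. \<forall>b<l.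
     (\<Sum>x<l. normal_form_unit l E a $$ (i, x) * B $$ (tensor_index l (i, x), tensor_index l (j, b)))
       = normal_form_unit l E a $$ (j, b))"
  by (auto simp: mat_eq_iff mat_block_def tensor_index_def row_matrix_def scalar_prod_def lessThan_atLeast0)

section \<open>The characterisation of sums of squares\<close>

theorem theorem1p1:
  fixes l m :: nat and P E :: "nat \<Rightarrow> real mat"
  assumes "m \<ge> 1" and "l \<ge> m + 2"
    and "symmetric_clifford_system (2 * l) m P"
    and "clifford_normal_form l m P E"
  shows "sum_of_squares_of_polys (2 * l) (G_F m P) \<longleftrightarrow>
    (\<exists>B \<in> carrier_mat (l^2) (l^2).
       pos_semidef (l^2) B \<and>
       (\<forall>i<l. mat_block l B i i = 1\<^sub>m l) \<and>
       (\<forall>i<l. \<forall>k<l. i \<noteq> k \<longrightarrow> mat_block l B i k = - transpose_mat (mat_block l B i k)) \<and>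
       (\<forall>i<l. \<forall>j<l. row_matrix l m E i * mat_block l B i j = row_matrix l m E j))"
    (is "_ \<longleftrightarrow> (\<exists>B \<in> _. ?conditions B)")
proof -
  let ?R = "\<lambda>q a j. normal_form_unit l E a $$ (q, j)"
  have orth: "(\<Sum>j<l. ?R q a j * ?R q b j) = (if a = b then 1 else 0)" if "q < l" "a < m" "b < m" for q a b
    using normal_form_rows_orthonormal[OF assms(4)] that by blast
  note bilinear = sum_of_squares_G_F_iff[OF assms(1,4)]
  show ?thesis
    unfolding bilinear
  proof
    assume "\<exists>(r::nat) c. \<forall>u v. biquadratic_gap l m ?R u v = (\<Sum>k<r. (bilin_form l (c k) u v)^2)"
    then obtain r c where
      rc: "\<And>u v. biquadratic_gap l m ?R u v = (\<Sum>k<(r::nat). (bilin_form l (c k) u v)^2)"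
      by blast
    define b where "b = (\<lambda>p q. (\<Sum>a<m. ?R (fst p) a (snd p) * ?R (fst q) a (snd q))
      + (\<Sum>t<r. c t (fst p) (snd p) * c t (fst q) (snd q)))"
    have b_eq: "b p q = (\<Sum>a<m. ?R (fst p) a (snd p) * ?R (fst q) a (snd q))
      + (\<Sum>t<r. c t (fst p) (snd p) * c t (fst q) (snd q))" for p q
      by (simp only: b_def)
    note gram = gram_conditions_of_bilinear_squares[of "{..<r}" l m ?R c, OF finite_lessThan orth rc b_eq]
    define B where "B = mat (l^2) (l^2) (\<lambda>(i, j). b (i div l, i mod l) (j div l, j mod l))"
    have B: "B \<in> carrier_mat (l^2) (l^2)" by (simp add: B_def)
    have entry: "B $$ (tensor_index l p, tensor_index l q) = b p q"
      if "p \<in> pair_range l" "q \<in> pair_range l" for p q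
    proof -
      have "tensor_index l p < l^2" "tensor_index l q < l^2"
        using that bij_betwE[OF bij_betw_tensor_index] by blast+
      then show ?thesis
        using that by (auto simp: B_def tensor_index_def)
    qed
    have "quad_form (pair_range l) (\<lambda>p q. B $$ (tensor_index l p, tensor_index l q)) y
        = quad_form (pair_range l) b y" for y
      unfolding quad_form_def by (rule sum.cong[OF refl], rule sum.cong[OF refl]) (simp add: entry)
    then have "pos_semidef (l^2) B"
      unfolding pos_semidef_iff_quad_form[OF B] using gram(1,2) entry by simp
    moreover have "mat_block l B i i = 1\<^sub>m l" if "i < l" for i
      unfolding mat_block_eq_one_iff
    proof (intro allI impI)
      fix a d assume "a < l" "d < l"
      have "b (i, a) (i, d) = b (i, d) (i, a)" by (rule gram(1))
      then show "B $$ (tensor_index l (i, a), tensor_index l (i, d)) = (if a = d then 1 else 0)"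
        using gram(3)[of i i a d] that \<open>a < l\<close> \<open>d < l\<close> by (simp add: entry split: if_splits)
    qed
    moreover have "mat_block l B i k = - transpose_mat (mat_block l B i k)"
      if "i < l" "k < l" "i \<noteq> k" for i k
      unfolding mat_block_skew_iff
    proof (intro allI impI)
      fix a d assume "a < l" "d < l"
      then show "B $$ (tensor_index l (i, a), tensor_index l (k, d))
          = - B $$ (tensor_index l (i, d), tensor_index l (k, a))"
        using gram(3)[of i k a d] that by (simp add: entry)
    qed
    moreover have "row_matrix l m E i * mat_block l B i j = row_matrix l m E j"
      if "i < l" "j < l" for i j
      unfolding row_matrix_mult_block_iff
    proof (intro allI impI)
      fix a d assume ad: "a < m" "d < l"
      have "(\<Sum>x<l. ?R i a x * B $$ (tensor_index l (i, x), tensor_index l (j, d)))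
          = (\<Sum>x<l. ?R i a x * b (i, x) (j, d))"
        using that ad by (intro sum.cong refl) (simp add: entry)
      also have "\<dots> = ?R j a d" using gram(4) that ad by blast
      finally show "(\<Sum>x<l. ?R i a x * B $$ (tensor_index l (i, x), tensor_index l (j, d)))
          = ?R j a d" .
    qed
    ultimately show "\<exists>B \<in> carrier_mat (l^2) (l^2). ?conditions B"
      using B by blast
  next
    assume "\<exists>B \<in> carrier_mat (l^2) (l^2). ?conditions B"
    then obtain B where B: "B \<in> carrier_mat (l^2) (l^2)" and cond: "?conditions B" by blast
    define b where "b = (\<lambda>p q. B $$ (tensor_index l p, tensor_index l q))"
    have "0 < l" using assms(2) by simp
    show "\<exists>(r::nat) c. \<forall>u v. biquadratic_gap l m ?R u v = (\<Sum>k<r. (bilin_form l (c k) u v)^2)"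
    proof (rule bilinear_squares_of_gram_conditions[of l m ?R b])
      show "0 < l" by fact
      show "(\<Sum>j<l. ?R 0 a j * ?R 0 d j) = (if a = d then 1 else 0)" if "a < m" "d < m" for a d
        using orth \<open>0 < l\<close> that by blast
      show "b p q = b q p" if "p \<in> pair_range l" "q \<in> pair_range l" for p q
        using cond that unfolding pos_semidef_iff_quad_form[OF B] b_def by blast
      show "0 \<le> quad_form (pair_range l) b y" for y
        using cond unfolding pos_semidef_iff_quad_form[OF B] b_def by blast
      show "b (i, a) (i, d) = (if a = d then 1 else 0)" if "i < l" "a < l" "d < l" for i a d
        using cond that unfolding mat_block_eq_one_iff b_def by blast
      show "b (i, a) (k, d) = - b (i, d) (k, a)" if "i < l" "k < l" "i \<noteq> k" "a < l" "d < l" for i k a d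
        using cond that unfolding mat_block_skew_iff b_def by blast
      show "(\<Sum>x<l. ?R 0 a x * b (0, x) (j, d)) = ?R j a d" if "j < l" "a < m" "d < l" for j a d
        using cond that \<open>0 < l\<close> unfolding row_matrix_mult_block_iff b_def by blast
    qed
  qed
qed

end
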